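(* Assume $\lambda_0\in(0,1)$ and $\|K_j-P_j\|\le \lambda_0$ for all $j\in[d]$. If for some $\eta_{\mathrm{RSG}}\in(0,1]$, $$\|P_{\mathrm{RSG}}-\Pi\|\le 1-\eta_{\mathrm{RSG}},$$ then $$\|P_{\mathrm{DCW}}-\Pi\|\le 1-\frac{(1-\lambda_0)^3}{8(d+1)(1+\lambda_0)}\,\eta_{\mathrm{RSG}}.$$
   Context: Let $[d]=\{1,\dots,d\}$. Let $(\mathcal X_j,\mathcal B_j)$, $j\in[d]$, be Polish measurable spaces, $\mathcal X=\prod_{j=1}^d\mathcal X_j$ with product $\sigma$-algebra, and $\Pi$ a probability measure on $\mathcal X$. Write $x=(x_1,\dots,x_d)$ and $x_{-j}=(x_i)_{i\ne j}$. Let $\Pi_j(\mathrm dx_j\mid x_{-j})$ be a (regular) conditional distribution of $x_j$ given $x_{-j}$ under $\Pi$. $L^2(\Pi)$ has inner product $\langle f,g\rangle_\Pi=\int fg\,\mathrm d\Pi$ and norm $\|\cdot\|_\Pi$; $\|\cdot\|$ denotes the operator norm on $L^2(\Pi)$; $\Pi$ also denotes the operator sending $f$ to the constant function $\int f\,\mathrm d\Pi$. A Markov kernel $K$ acts by $(Kf)(x)=\int f(y)K(x,\mathrm dy)$. Gibbs update: $(P_jf)(x_j,x_{-j})=\int f(y_j,x_{-j})\,\Pi_j(\mathrm dy_j\mid x_{-j})$. Component-wise update: for each $j$ and $x_{-j}$, $K_{j,x_{-j}}$ is a Markov kernel on $\mathcal X_j$ reversible with respect to $\Pi_j(\cdot\mid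 x_{-j})$, with $(x_j,x_{-j})\mapsto K_{j,x_{-j}}(x_j,A_j)$ measurable for each $A_j\in\mathcal B_j$, and $(K_jf)(x_j,x_{-j})=\int f(y_j,x_{-j})\,K_{j,x_{-j}}(x_j,\mathrm dy_j)$. Random-scan Gibbs kernel: $P_{\mathrm{RSG}}=\frac1d\sum_{j=1}^dP_j$. Deterministic-scan component-wise kernel: $P_{\mathrm{DCW}}=K_d\cdots K_1$. *)

theory Defs
  imports "HOL-Probability.Probability"
begin

text \<open>
  The measure component of \<open>X\<close> is irrelevant in \<open>polish_measurable_space X\<close>: the
  \<open>measure\<close> type is used as a carrier with a sigma-algebra, as in the library's \<open>Pi\<^sub>M\<close>.
\<close>

definition polish_measurable_space :: "'a measure \<Rightarrow> bool" where
  "polish_measurable_space X \<longleftrightarrow>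
    (\<exists>T. topspace T = space X \<and> completely_metrizable_space T \<and> second_countable T \<and>
         sets X = sigma_sets (space X) {U. openin T U})"


definition L2 :: "'b measure \<Rightarrow> ('b \<Rightarrow> real) set" where
  "L2 Q = {f \<in> borel_measurable Q. integrable Q (\<lambda>x. (f x)\<^sup>2)}"

definition L2_norm :: "'b measure \<Rightarrow> ('b \<Rightarrow> real) \<Rightarrow> real" where
  "L2_norm Q f = sqrt (\<integral>x. (f x)\<^sup>2 \<partial>Q)"

text \<open>
  Operators act on representatives of \<open>L\<^sup>2\<close> classes.  The norm is the least bound, taken in
  \<open>ereal\<close>, so that it is infinite for an operator that is unbounded or that does
  not map \<open>L\<^sup>2\<close> into itself.
\<close>

definition L2_opnorm :: "'b measure \<Rightarrow> (('b \<Rightarrow> real) \<Rightarrow> ('b \<Rightarrow> real)) \<Rightarrow> ereal" where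
  "L2_opnorm Q T =
    (INF c \<in> {c. 0 \<le> c \<and> (\<forall>f \<in> L2 Q. T f \<in> L2 Q \<and> L2_norm Q (T f) \<le> c * L2_norm Q f)}. ereal c)"

definition mean_operator :: "'b measure \<Rightarrow> ('b \<Rightarrow> real) \<Rightarrow> ('b \<Rightarrow> real)" where
  "mean_operator Q f = (\<lambda>_. \<integral>y. f y \<partial>Q)"


definition markov_kernel :: "'a measure \<Rightarrow> ('a \<Rightarrow> 'a measure) \<Rightarrow> bool" where
  "markov_kernel X k \<longleftrightarrow> k \<in> X \<rightarrow>\<^sub>M prob_algebra X"

definition reversible_wrt :: "'a measure \<Rightarrow> ('a \<Rightarrow> 'a measure) \<Rightarrow> bool" where
  "reversible_wrt p k \<longleftrightarrow>
    (\<forall>A \<in> sets p. \<forall>B \<in> sets p.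
       (\<integral>\<^sup>+ y\<in>A. emeasure (k y) B \<partial>p) = (\<integral>\<^sup>+ y\<in>B. emeasure (k y) A \<partial>p))"

text \<open>
  Points of the product over \<open>I\<close> are extensional functions; \<open>x\<^sub>-\<^sub>j\<close> is the restriction of \<open>x\<close> to
  \<open>I - {j}\<close>, and \<open>(y\<^sub>j, x\<^sub>-\<^sub>j)\<close> is the update \<open>x(j := y)\<close>.
\<close>

definition omit :: "'i set \<Rightarrow> 'i \<Rightarrow> ('i \<Rightarrow> 'a) \<Rightarrow> ('i \<Rightarrow> 'a)" where
  "omit I j x = restrict x (I - {j})"

definition regular_conditional_distribution ::
  "'i set \<Rightarrow> ('i \<Rightarrow> 'a measure) \<Rightarrow> ('i \<Rightarrow> 'a) measure \<Rightarrow> 'i \<Rightarrow> (('i \<Rightarrow> 'a) \<Rightarrow> 'a measure) \<Rightarrow> bool" where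
  "regular_conditional_distribution I X Q j p \<longleftrightarrow>
    p \<in> Pi\<^sub>M (I - {j}) X \<rightarrow>\<^sub>M prob_algebra (X j) \<and>
    (\<forall>A \<in> sets (X j). \<forall>B \<in> sets (Pi\<^sub>M (I - {j}) X).
       emeasure Q {x \<in> space Q. x j \<in> A \<and> omit I j x \<in> B} =
       (\<integral>\<^sup>+ z\<in>B. emeasure (p z) A \<partial>distr Q (Pi\<^sub>M (I - {j}) X) (omit I j)))"

text \<open>
  \<open>p z\<close> is the conditional distribution of the \<open>j\<close>-th coordinate given \<open>x\<^sub>-\<^sub>j = z\<close>, and \<open>k z\<close> is the
  update kernel \<open>K\<^sub>j\<^sub>,\<^sub>z\<close>.
\<close>

definition componentwise_kernel ::
  "'i set \<Rightarrow> ('i \<Rightarrow> 'a measure) \<Rightarrow> 'i \<Rightarrow> (('i \<Rightarrow> 'a) \<Rightarrow> 'a measure) \<Rightarrow>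
   (('i \<Rightarrow> 'a) \<Rightarrow> 'a \<Rightarrow> 'a measure) \<Rightarrow> bool" where
  "componentwise_kernel I X j p k \<longleftrightarrow>
    (\<forall>z \<in> space (Pi\<^sub>M (I - {j}) X). markov_kernel (X j) (k z) \<and> reversible_wrt (p z) (k z)) \<and>
    (\<forall>A \<in> sets (X j). (\<lambda>x. emeasure (k (omit I j x) (x j)) A) \<in> borel_measurable (Pi\<^sub>M I X))"

definition gibbs_update ::
  "'i set \<Rightarrow> 'i \<Rightarrow> (('i \<Rightarrow> 'a) \<Rightarrow> 'a measure) \<Rightarrow> (('i \<Rightarrow> 'a) \<Rightarrow> real) \<Rightarrow> (('i \<Rightarrow> 'a) \<Rightarrow> real)" where
  "gibbs_update I j p f = (\<lambda>x. \<integral>y. f (x(j := y)) \<partial>p (omit I j x))"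

definition componentwise_update ::
  "'i set \<Rightarrow> 'i \<Rightarrow> (('i \<Rightarrow> 'a) \<Rightarrow> 'a \<Rightarrow> 'a measure) \<Rightarrow>
   (('i \<Rightarrow> 'a) \<Rightarrow> real) \<Rightarrow> (('i \<Rightarrow> 'a) \<Rightarrow> real)" where
  "componentwise_update I j k f = (\<lambda>x. \<integral>y. f (x(j := y)) \<partial>k (omit I j x) (x j))"

definition random_scan_gibbs ::
  "nat \<Rightarrow> (nat \<Rightarrow> (nat \<Rightarrow> 'a) \<Rightarrow> 'a measure) \<Rightarrow>
   ((nat \<Rightarrow> 'a) \<Rightarrow> real) \<Rightarrow> ((nat \<Rightarrow> 'a) \<Rightarrow> real)" where
  "random_scan_gibbs d p f = (\<lambda>x. (1 / real d) * (\<Sum>j = 1..d. gibbs_update {1..d} j (p j) f x))"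

text \<open>The first coordinate is updated innermost: the operator is \<open>K\<^sub>d \<circ> \<dots> \<circ> K\<^sub>1\<close>.\<close>

definition deterministic_scan_componentwise ::
  "nat \<Rightarrow> (nat \<Rightarrow> (nat \<Rightarrow> 'a) \<Rightarrow> 'a \<Rightarrow> 'a measure) \<Rightarrow>
   ((nat \<Rightarrow> 'a) \<Rightarrow> real) \<Rightarrow> ((nat \<Rightarrow> 'a) \<Rightarrow> real)" where
  "deterministic_scan_componentwise d k =
    fold (\<lambda>j. componentwise_update {1..d} j (k j)) [1..<Suc d]"

end

theory Submission
  imports Defs
begin

text \<open>
  Work in \<open>L\<^sup>2(Q)\<close> and write \<open>\<lambda>\<^sub>0\<close> for \<open>lam\<close>. Each Gibbs update \<open>P\<^sub>j\<close> is the orthogonal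
  projection onto the functions that do not
  depend on the \<open>j\<close>-th coordinate. Each update \<open>K\<^sub>j\<close> fixes those functions, and stationarity makes
  \<open>K\<^sub>j u - P\<^sub>j u\<close> orthogonal to them. Hence \<open>K\<^sub>j u = P\<^sub>j u + (K\<^sub>j - P\<^sub>j) (u - P\<^sub>j u)\<close> is an orthogonal
  decomposition whose second summand has norm at most \<open>\<lambda>\<^sub>0 \<parallel>u - P\<^sub>j u\<parallel>\<close>. Two consequences are used, for
  any constant \<open>c\<close>:

  \<^item> energy loss: \<open>\<parallel>K\<^sub>j u - c\<parallel>\<^sup>2 \<le> \<parallel>u - c\<parallel>\<^sup>2 - (1 - \<lambda>\<^sub>0\<^sup>2) \<parallel>u - P\<^sub>j u\<parallel>\<^sup>2\<close>
    (\<open>componentwise_update_energy\<close>);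

  \<^item> small displacement: \<open>\<parallel>u - K\<^sub>j u\<parallel> \<le> (1 + \<lambda>\<^sub>0) \<parallel>u - P\<^sub>j u\<parallel>\<close>
    (\<open>componentwise_update_displacement\<close>).

  Let \<open>u\<^sub>0 = f\<close>, \<open>u\<^sub>j = K\<^sub>j u\<^sub>j\<^sub>-\<^sub>1\<close>, \<open>a\<^sub>j = \<parallel>u\<^sub>j\<^sub>-\<^sub>1 - P\<^sub>j u\<^sub>j\<^sub>-\<^sub>1\<parallel>\<close>, and let \<open>c\<close> be the mean of \<open>f\<close>. If the sweep
  loses little energy, then all \<open>a\<^sub>j\<close> are small, so \<open>f\<close> hardly moves during the sweep and is itself close
  to the range of every \<open>P\<^sub>j\<close>: since \<open>P\<^sub>j\<close> is a best approximation (\<open>gibbs_residual_le\<close>),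
  \<open>\<parallel>f - P\<^sub>j f\<parallel> \<le> (1 + \<lambda>\<^sub>0) (a\<^sub>1 + \<dots> + a\<^sub>j)\<close>. But the spectral gap of the random scan says that
  \<open>\<Sum>\<^sub>j \<parallel>g - P\<^sub>j g\<parallel>\<^sup>2 \<ge> d \<eta> \<parallel>g\<parallel>\<^sup>2\<close> for \<open>g = f - c\<close> (\<open>random_scan_gap\<close>),
  where \<open>g - P\<^sub>j g = f - P\<^sub>j f\<close>. Cauchy--Schwarz turns these
  two bounds into a lower bound for \<open>\<Sum>\<^sub>j a\<^sub>j\<^sup>2\<close> and therefore for the energy lost
  (\<open>sweep_contraction\<close>). The factor \<open>d + 1\<close> of the rate comes from \<open>1 + \<dots> + d = d (d + 1) / 2\<close>.
\<close>

section \<open>Square-integrable functions\<close>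

definition L2_inner :: "'b measure \<Rightarrow> ('b \<Rightarrow> real) \<Rightarrow> ('b \<Rightarrow> real) \<Rightarrow> real" where
  "L2_inner Q f g = (\<integral>x. f x * g x \<partial>Q)"

lemma L2_measurable: "f \<in> L2 Q \<Longrightarrow> f \<in> borel_measurable Q"
  by (simp add: L2_def)

lemma L2_mult_integrable:
  assumes "f \<in> L2 Q" "g \<in> L2 Q"
  shows "integrable Q (\<lambda>x. f x * g x)"
proof (rule Bochner_Integration.integrable_bound)
  show "integrable Q (\<lambda>x. (f x)\<^sup>2 + (g x)\<^sup>2)"
    using assms by (auto simp: L2_def)
  show "(\<lambda>x. f x * g x) \<in> borel_measurable Q"
    using assms by (auto simp: L2_def)
  show "AE x in Q. norm (f x * g x) \<le> norm ((f x)\<^sup>2 + (g x)\<^sup>2)"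
  proof (rule AE_I2)
    fix x
    have "2 * (\<bar>f x\<bar> * \<bar>g x\<bar>) \<le> (f x)\<^sup>2 + (g x)\<^sup>2"
      using sum_squares_bound[of "\<bar>f x\<bar>" "\<bar>g x\<bar>"] by (simp add: algebra_simps)
    moreover have "0 \<le> \<bar>f x\<bar> * \<bar>g x\<bar>" by simp
    ultimately have "\<bar>f x\<bar> * \<bar>g x\<bar> \<le> (f x)\<^sup>2 + (g x)\<^sup>2" by linarith
    then show "norm (f x * g x) \<le> norm ((f x)\<^sup>2 + (g x)\<^sup>2)"
      by (simp add: abs_mult)
  qed
qed

lemma L2_cmult:
  assumes "f \<in> L2 Q"
  shows "(\<lambda>x. c * f x) \<in> L2 Q"
  using assms by (auto simp: L2_def power_mult_distrib)

lemma L2_add: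
  assumes "f \<in> L2 Q" "g \<in> L2 Q"
  shows "(\<lambda>x. f x + g x) \<in> L2 Q"
proof -
  have "integrable Q (\<lambda>x. (f x)\<^sup>2 + (g x)\<^sup>2 + 2 * (f x * g x))"
    using assms L2_mult_integrable[OF assms] by (auto simp: L2_def)
  then show ?thesis
    using assms by (auto simp: L2_def power2_sum mult.assoc)
qed

lemma L2_diff:
  assumes "f \<in> L2 Q" "g \<in> L2 Q"
  shows "(\<lambda>x. f x - g x) \<in> L2 Q"
  using L2_add[OF assms(1) L2_cmult[OF assms(2), of "-1"]] by simp

lemma L2_const:
  assumes "finite_measure Q"
  shows "(\<lambda>_. c) \<in> L2 Q"
  using assms by (auto simp: L2_def finite_measure.integrable_const)

lemma L2_integrable:
  assumes "finite_measure Q" "f \<in> L2 Q"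
  shows "integrable Q f"
  using L2_mult_integrable[OF assms(2) L2_const[OF assms(1), of 1]] by simp

lemma L2_cong:
  assumes "\<And>x. x \<in> space Q \<Longrightarrow> f x = g x"
  shows "f \<in> L2 Q \<longleftrightarrow> g \<in> L2 Q"
  using assms measurable_cong[of Q f g borel]
    Bochner_Integration.integrable_cong[OF refl, of Q "\<lambda>x. (f x)\<^sup>2" "\<lambda>x. (g x)\<^sup>2"]
  by (simp add: L2_def)

lemma L2_inner_cong:
  assumes "\<And>x. x \<in> space Q \<Longrightarrow> f x = g x"
  shows "L2_inner Q h f = L2_inner Q h g"
  unfolding L2_inner_def using assms by (intro Bochner_Integration.integral_cong) auto

lemma L2_norm_nonneg [simp]: "0 \<le> L2_norm Q f"
  by (simp add: L2_norm_def)

lemma L2_norm_square: "(L2_norm Q f)\<^sup>2 = L2_inner Q f f"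
  by (simp add: L2_norm_def L2_inner_def power2_eq_square)

lemma L2_inner_commute: "L2_inner Q f g = L2_inner Q g f"
  by (simp add: L2_inner_def mult.commute)

lemma L2_inner_add_right:
  assumes "f \<in> L2 Q" "g \<in> L2 Q" "h \<in> L2 Q"
  shows "L2_inner Q f (\<lambda>x. g x + h x) = L2_inner Q f g + L2_inner Q f h"
  unfolding L2_inner_def distrib_left
  by (intro Bochner_Integration.integral_add L2_mult_integrable assms)

lemma L2_inner_diff_right:
  assumes "f \<in> L2 Q" "g \<in> L2 Q" "h \<in> L2 Q"
  shows "L2_inner Q f (\<lambda>x. g x - h x) = L2_inner Q f g - L2_inner Q f h"
  unfolding L2_inner_def right_diff_distrib
  by (intro Bochner_Integration.integral_diff L2_mult_integrable assms)

lemma L2_norm_add_square: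
  assumes "f \<in> L2 Q" "g \<in> L2 Q"
  shows "(L2_norm Q (\<lambda>x. f x + g x))\<^sup>2 = (L2_norm Q f)\<^sup>2 + 2 * L2_inner Q f g + (L2_norm Q g)\<^sup>2"
proof -
  have "(L2_norm Q (\<lambda>x. f x + g x))\<^sup>2
      = L2_inner Q f (\<lambda>x. f x + g x) + L2_inner Q g (\<lambda>x. f x + g x)"
    unfolding L2_norm_square L2_inner_add_right[OF L2_add[OF assms] assms]
      L2_inner_commute[of Q "\<lambda>x. f x + g x" f] L2_inner_commute[of Q "\<lambda>x. f x + g x" g] ..
  also have "\<dots> = (L2_norm Q f)\<^sup>2 + 2 * L2_inner Q f g + (L2_norm Q g)\<^sup>2"
    unfolding L2_norm_square L2_inner_add_right[OF assms(1) assms] L2_inner_add_right[OF assms(2) assms]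
      L2_inner_commute[of Q g f] by simp
  finally show ?thesis .
qed

lemma L2_norm_cong_AE:
  assumes "f \<in> L2 Q" "g \<in> L2 Q" "AE x in Q. f x = g x"
  shows "L2_norm Q f = L2_norm Q g"
  unfolding L2_norm_def using assms
  by (intro arg_cong[where f=sqrt] integral_cong_AE) (auto simp: L2_def)

lemma L2_Cauchy_Schwarz:
  assumes "f \<in> L2 Q" "g \<in> L2 Q"
  shows "L2_inner Q f g \<le> L2_norm Q f * L2_norm Q g"
proof -
  note [measurable] = assms[THEN L2_measurable]
  have sq: "(\<integral>\<^sup>+x. ennreal ((u x)\<^sup>2) \<partial>Q) = ennreal ((L2_norm Q u)\<^sup>2)" if "u \<in> L2 Q" for u
    using that nn_integral_eq_integral[of Q "\<lambda>x. (u x)\<^sup>2"]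
    by (simp add: L2_def L2_norm_def ennreal_power)
  have int: "integrable Q (\<lambda>x. \<bar>f x\<bar> * \<bar>g x\<bar>)"
    using L2_mult_integrable[OF assms] by (simp flip: abs_mult)
  have nonneg: "0 \<le> (\<integral>x. \<bar>f x\<bar> * \<bar>g x\<bar> \<partial>Q)"
    by (simp add: integral_nonneg_AE)
  have "(\<integral>\<^sup>+x. ennreal \<bar>f x\<bar> * ennreal \<bar>g x\<bar> \<partial>Q) = ennreal (\<integral>x. \<bar>f x\<bar> * \<bar>g x\<bar> \<partial>Q)"
    using nn_integral_eq_integral[OF int] by (simp add: ennreal_mult)
  then have "ennreal ((\<integral>x. \<bar>f x\<bar> * \<bar>g x\<bar> \<partial>Q)\<^sup>2)
      \<le> ennreal ((L2_norm Q f)\<^sup>2) * ennreal ((L2_norm Q g)\<^sup>2)"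
    using Cauchy_Schwarz_nn_integral[of "\<lambda>x. ennreal \<bar>f x\<bar>" Q "\<lambda>x. ennreal \<bar>g x\<bar>"] nonneg
    by (simp add: sq assms ennreal_power)
  then have "(\<integral>x. \<bar>f x\<bar> * \<bar>g x\<bar> \<partial>Q)\<^sup>2 \<le> (L2_norm Q f * L2_norm Q g)\<^sup>2"
    by (simp add: ennreal_mult[symmetric] power_mult_distrib)
  then have "(\<integral>x. \<bar>f x\<bar> * \<bar>g x\<bar> \<partial>Q) \<le> L2_norm Q f * L2_norm Q g"
    by (rule power2_le_imp_le) simp
  moreover have "L2_inner Q f g \<le> (\<integral>x. \<bar>f x\<bar> * \<bar>g x\<bar> \<partial>Q)"
    unfolding L2_inner_def using L2_mult_integrable[OF assms] int
    by (intro integral_mono) (auto simp flip: abs_mult)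
  ultimately show ?thesis by simp
qed

lemma L2_norm_triangle:
  assumes "f \<in> L2 Q" "g \<in> L2 Q"
  shows "L2_norm Q (\<lambda>x. f x + g x) \<le> L2_norm Q f + L2_norm Q g"
proof (rule power2_le_imp_le)
  have "(L2_norm Q f + L2_norm Q g)\<^sup>2
      = (L2_norm Q f)\<^sup>2 + 2 * (L2_norm Q f * L2_norm Q g) + (L2_norm Q g)\<^sup>2"
    by (simp only: power2_sum mult.assoc add_ac)
  then show "(L2_norm Q (\<lambda>x. f x + g x))\<^sup>2 \<le> (L2_norm Q f + L2_norm Q g)\<^sup>2"
    using L2_Cauchy_Schwarz[OF assms] L2_norm_add_square[OF assms] by linarith
  show "0 \<le> L2_norm Q f + L2_norm Q g"
    by (intro add_nonneg_nonneg L2_norm_nonneg)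
qed

lemma L2_norm_triangle_diff:
  assumes "f \<in> L2 Q" "g \<in> L2 Q" "h \<in> L2 Q"
  shows "L2_norm Q (\<lambda>x. f x - h x) \<le> L2_norm Q (\<lambda>x. f x - g x) + L2_norm Q (\<lambda>x. g x - h x)"
proof -
  have "(\<lambda>x. f x - h x) = (\<lambda>x. (f x - g x) + (g x - h x))" by auto
  then show ?thesis
    using L2_norm_triangle[OF L2_diff[OF assms(1,2)] L2_diff[OF assms(2,3)]] by (simp only:)
qed

text \<open>
  The operator norm is an infimum, so a bound on it only yields admissible constants below \<open>c + e\<close>
  for every positive \<open>e\<close>; letting \<open>e\<close> tend to \<open>0\<close> makes \<open>c\<close> itself admissible.
\<close>

lemma L2_opnorm_leD:
  assumes le: "L2_opnorm Q T \<le> ereal c" and f: "f \<in> L2 Q"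
  shows "T f \<in> L2 Q" and "L2_norm Q (T f) \<le> c * L2_norm Q f"
proof -
  have ex: "\<exists>c'. c' < c + e \<and> T f \<in> L2 Q \<and> L2_norm Q (T f) \<le> c' * L2_norm Q f" if "0 < e" for e
  proof -
    have "L2_opnorm Q T < ereal (c + e)"
      using le by (rule order_le_less_trans) (use that in simp)
    then show ?thesis
      using f unfolding L2_opnorm_def INF_less_iff by auto
  qed
  show "T f \<in> L2 Q" using ex[of 1] by auto
  show "L2_norm Q (T f) \<le> c * L2_norm Q f"
  proof (rule field_le_epsilon)
    fix e :: real assume "0 < e"
    define e' where "e' = e / (L2_norm Q f + 1)"
    have pos: "0 < L2_norm Q f + 1" using L2_norm_nonneg[of Q f] by linarith
    have "0 < e'" using \<open>0 < e\<close> pos by (simp add: e'_def)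
    then obtain c' where c': "c' < c + e'" "L2_norm Q (T f) \<le> c' * L2_norm Q f"
      using ex by blast
    have "c' * L2_norm Q f \<le> (c + e') * L2_norm Q f"
      using c'(1) by (intro mult_right_mono) auto
    also have "e' * L2_norm Q f \<le> e"
      using pos \<open>0 < e\<close> by (simp add: e'_def field_simps)
    then have "(c + e') * L2_norm Q f \<le> c * L2_norm Q f + e"
      by (simp add: distrib_right)
    finally show "L2_norm Q (T f) \<le> c * L2_norm Q f + e"
      using c'(2) by linarith
  qed
qed

lemma L2_opnorm_leI:
  assumes "0 \<le> c" and "\<And>f. f \<in> L2 Q \<Longrightarrow> T f \<in> L2 Q"
    and "\<And>f. f \<in> L2 Q \<Longrightarrow> L2_norm Q (T f) \<le> c * L2_norm Q f"
  shows "L2_opnorm Q T \<le> ereal c"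
  unfolding L2_opnorm_def using assms by (intro INF_lower) auto

section \<open>Stationary Markov kernels\<close>

locale stationary_kernel = prob_space Q for Q :: "'b measure" +
  fixes \<kappa> :: "'b \<Rightarrow> 'b measure"
  assumes markov: "markov_kernel Q \<kappa>"
    and stationary: "Q \<bind> \<kappa> = Q"
begin

lemma subprob_measurable [measurable]: "\<kappa> \<in> Q \<rightarrow>\<^sub>M subprob_algebra Q"
  using markov unfolding markov_kernel_def by (rule measurable_prob_algebraD)

lemma sets_kernel: "x \<in> space Q \<Longrightarrow> sets (\<kappa> x) = sets Q"
  using sets_kernel[OF subprob_measurable] by simp

lemma prob_space_kernel: "x \<in> space Q \<Longrightarrow> prob_space (\<kappa> x)"
  using markov measurable_space[of \<kappa> Q "prob_algebra Q" x]
  by (auto simp: markov_kernel_def space_prob_algebra)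

lemma borel_measurable_kernel:
  "x \<in> space Q \<Longrightarrow> borel_measurable (\<kappa> x) = borel_measurable Q"
  by (intro measurable_cong_sets sets_kernel refl)

lemma nn_integral_kernel:
  assumes "f \<in> borel_measurable Q"
  shows "(\<integral>\<^sup>+x. \<integral>\<^sup>+y. f y \<partial>\<kappa> x \<partial>Q) = (\<integral>\<^sup>+x. f x \<partial>Q)"
  using nn_integral_bind[OF assms subprob_measurable] by (simp add: stationary)

lemma kernel_integral_measurable [measurable]:
  fixes f :: "'b \<Rightarrow> real"
  assumes "f \<in> borel_measurable Q"
  shows "(\<lambda>x. \<integral>y. f y \<partial>\<kappa> x) \<in> borel_measurable Q"
  using measurable_compose[OF subprob_measurable integral_measurable_subprob_algebra[OF assms]] .

text \<open>
  For an integrable \<open>f\<close> the kernel integral can diverge, and then has the default value \<open>0\<close>, only on a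
  null set of starting points. Linearity of the kernel operator therefore holds almost everywhere only.
\<close>

lemma AE_integrable_kernel:
  fixes f :: "'b \<Rightarrow> real"
  assumes "integrable Q f"
  shows "AE x in Q. integrable (\<kappa> x) f"
proof -
  have [measurable]: "f \<in> borel_measurable Q" using assms by auto
  have m: "(\<lambda>x. \<integral>\<^sup>+y. ennreal (norm (f y)) \<partial>\<kappa> x) \<in> borel_measurable Q"
    by (rule measurable_compose[OF subprob_measurable nn_integral_measurable_subprob_algebra]) simp
  have "(\<integral>\<^sup>+x. \<integral>\<^sup>+y. ennreal (norm (f y)) \<partial>\<kappa> x \<partial>Q) \<noteq> \<infinity>"
    using assms by (subst nn_integral_kernel) (auto simp: integrable_iff_bounded)
  then have "AE x in Q. (\<integral>\<^sup>+y. ennreal (norm (f y)) \<partial>\<kappa> x) \<noteq> \<infinity>"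
    by (intro nn_integral_PInf_AE m) auto
  then show ?thesis
    by (rule AE_mp) (auto intro!: AE_I2 simp: integrable_iff_bounded borel_measurable_kernel less_top)
qed

lemma kernel_integral_nonneg:
  fixes f :: "'b \<Rightarrow> real"
  assumes int: "integrable Q f" and nonneg: "\<And>x. 0 \<le> f x"
  shows "integrable Q (\<lambda>x. \<integral>y. f y \<partial>\<kappa> x)" and "(\<integral>x. \<integral>y. f y \<partial>\<kappa> x \<partial>Q) = (\<integral>x. f x \<partial>Q)"
proof -
  have [measurable]: "f \<in> borel_measurable Q" using int by auto
  have "(\<integral>\<^sup>+x. ennreal (\<integral>y. f y \<partial>\<kappa> x) \<partial>Q) = (\<integral>\<^sup>+x. \<integral>\<^sup>+y. ennreal (f y) \<partial>\<kappa> x \<partial>Q)"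
    using AE_integrable_kernel[OF int]
    by (intro nn_integral_cong_AE, elim AE_mp) (auto intro!: AE_I2 simp: nn_integral_eq_integral nonneg)
  also have "\<dots> = (\<integral>\<^sup>+x. ennreal (f x) \<partial>Q)"
    by (rule nn_integral_kernel) simp
  also have "\<dots> = ennreal (\<integral>x. f x \<partial>Q)"
    by (intro nn_integral_eq_integral int) (simp add: nonneg)
  finally have eq: "(\<integral>\<^sup>+x. ennreal (\<integral>y. f y \<partial>\<kappa> x) \<partial>Q) = ennreal (\<integral>x. f x \<partial>Q)" .
  have "has_bochner_integral Q (\<lambda>x. \<integral>y. f y \<partial>\<kappa> x) (\<integral>x. f x \<partial>Q)"
    by (rule has_bochner_integral_nn_integral[OF _ _ _ eq])
       (auto intro!: Bochner_Integration.integral_nonneg simp: nonneg)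
  then show "integrable Q (\<lambda>x. \<integral>y. f y \<partial>\<kappa> x)" and "(\<integral>x. \<integral>y. f y \<partial>\<kappa> x \<partial>Q) = (\<integral>x. f x \<partial>Q)"
    by (auto simp: has_bochner_integral_iff)
qed

lemma kernel_integral:
  fixes f :: "'b \<Rightarrow> real"
  assumes int: "integrable Q f"
  shows "(\<integral>x. \<integral>y. f y \<partial>\<kappa> x \<partial>Q) = (\<integral>x. f x \<partial>Q)"
proof -
  have [measurable]: "f \<in> borel_measurable Q" using int by auto
  let ?p = "\<lambda>x. max (f x) 0" and ?n = "\<lambda>x. max (- f x) 0"
  have p: "integrable Q ?p" and n: "integrable Q ?n"
    using int by auto
  have f: "f = (\<lambda>x. ?p x - ?n x)" by auto
  have "(\<integral>x. \<integral>y. f y \<partial>\<kappa> x \<partial>Q) = (\<integral>x. (\<integral>y. ?p y \<partial>\<kappa> x) - (\<integral>y. ?n y \<partial>\<kappa> x) \<partial>Q)"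
  proof (rule integral_cong_AE)
    show "AE x in Q. (\<integral>y. f y \<partial>\<kappa> x) = (\<integral>y. ?p y \<partial>\<kappa> x) - (\<integral>y. ?n y \<partial>\<kappa> x)"
      using AE_integrable_kernel[OF p] AE_integrable_kernel[OF n]
    proof eventually_elim
      case (elim x)
      then show ?case by (subst f) (rule Bochner_Integration.integral_diff)
    qed
  qed auto
  also have "\<dots> = (\<integral>x. \<integral>y. ?p y \<partial>\<kappa> x \<partial>Q) - (\<integral>x. \<integral>y. ?n y \<partial>\<kappa> x \<partial>Q)"
    by (intro Bochner_Integration.integral_diff kernel_integral_nonneg(1) p n) auto
  also have "\<dots> = (\<integral>x. ?p x \<partial>Q) - (\<integral>x. ?n x \<partial>Q)"
    by (simp add: kernel_integral_nonneg(2) p n)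
  also have "\<dots> = (\<integral>x. f x \<partial>Q)"
    by (subst (3) f) (rule Bochner_Integration.integral_diff[symmetric, OF p n])
  finally show ?thesis .
qed

text \<open>
  Jensen's inequality, in the form that the variance under \<open>\<kappa> x\<close> is nonnegative.
\<close>

lemma kernel_L2:
  assumes f: "f \<in> L2 Q"
  shows "(\<lambda>x. \<integral>y. f y \<partial>\<kappa> x) \<in> L2 Q"
proof -
  have [measurable]: "f \<in> borel_measurable Q" using f by (rule L2_measurable)
  have int: "integrable Q (\<lambda>x. (f x)\<^sup>2)" using f by (simp add: L2_def)
  have "integrable Q (\<lambda>x. (\<integral>y. f y \<partial>\<kappa> x)\<^sup>2)"
  proof (rule Bochner_Integration.integrable_bound[OF kernel_integral_nonneg(1)[OF int]])
    show "AE x in Q. norm ((\<integral>y. f y \<partial>\<kappa> x)\<^sup>2) \<le> norm (\<integral>y. (f y)\<^sup>2 \<partial>\<kappa> x)"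
      using AE_integrable_kernel[OF int] AE_integrable_kernel[OF L2_integrable[OF finite_measure_axioms f]]
        AE_space
    proof eventually_elim
      case (elim x)
      interpret \<kappa>: prob_space "\<kappa> x" using elim(3) by (rule prob_space_kernel)
      have "(\<integral>y. f y \<partial>\<kappa> x)\<^sup>2 \<le> (\<integral>y. (f y)\<^sup>2 \<partial>\<kappa> x)"
        using \<kappa>.variance_positive[of f] \<kappa>.variance_eq[OF elim(2,1)] by simp
      then show ?case by simp
    qed
  qed auto
  then show ?thesis by (simp add: L2_def)
qed

text \<open>
  A function that the kernel cannot change is pulled out of the kernel integral, and stationarity then
  removes the kernel. This single computation provides the self-adjointness of the Gibbs
  projections and the orthogonality of \<open>K\<^sub>j - P\<^sub>j\<close> to their range.
\<close>

lemma L2_inner_kernel: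
  assumes h: "h \<in> L2 Q" and g: "g \<in> L2 Q"
    and inv: "\<And>x. x \<in> space Q \<Longrightarrow> AE y in \<kappa> x. h y = h x"
  shows "L2_inner Q h (\<lambda>x. \<integral>y. g y \<partial>\<kappa> x) = L2_inner Q h g"
proof -
  have [measurable]: "h \<in> borel_measurable Q" "g \<in> borel_measurable Q"
    using h g by (auto dest: L2_measurable)
  have "L2_inner Q h g = (\<integral>x. \<integral>y. h y * g y \<partial>\<kappa> x \<partial>Q)"
    unfolding L2_inner_def by (rule kernel_integral[symmetric]) (rule L2_mult_integrable[OF h g])
  also have "\<dots> = (\<integral>x. h x * (\<integral>y. g y \<partial>\<kappa> x) \<partial>Q)"
  proof (rule Bochner_Integration.integral_cong[OF refl])
    fix x assume x: "x \<in> space Q"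
    have "(\<integral>y. h y * g y \<partial>\<kappa> x) = (\<integral>y. h x * g y \<partial>\<kappa> x)"
      using inv[OF x] by (intro integral_cong_AE) (auto simp: borel_measurable_kernel[OF x])
    then show "(\<integral>y. h y * g y \<partial>\<kappa> x) = h x * (\<integral>y. g y \<partial>\<kappa> x)" by simp
  qed
  finally show ?thesis by (simp add: L2_inner_def)
qed

lemma kernel_integral_diff_invariant:
  fixes u h :: "'b \<Rightarrow> real"
  assumes x: "x \<in> space Q" and int: "integrable (\<kappa> x) u" and h: "h \<in> borel_measurable Q"
    and inv: "AE y in \<kappa> x. h y = h x"
  shows "(\<integral>y. u y - h y \<partial>\<kappa> x) = (\<integral>y. u y \<partial>\<kappa> x) - h x"
proof -
  interpret \<kappa>: prob_space "\<kappa> x" using x by (rule prob_space_kernel)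
  have [measurable]: "h \<in> borel_measurable (\<kappa> x)" using h by (simp add: borel_measurable_kernel x)
  have "(\<integral>y. u y - h y \<partial>\<kappa> x) = (\<integral>y. u y - h x \<partial>\<kappa> x)"
    using inv int by (intro integral_cong_AE) auto
  also have "\<dots> = (\<integral>y. u y \<partial>\<kappa> x) - h x"
    using int by (simp add: \<kappa>.prob_space)
  finally show ?thesis .
qed

end

section \<open>Resampling one coordinate\<close>

text \<open>
  Realises the move that redraws coordinate \<open>j\<close> of \<open>x\<close> from \<open>q x\<close> as a kernel on the whole product, so
  that the results on stationary kernels apply to both kinds of update.
\<close>

definition coordinate_kernel ::
  "'i set \<Rightarrow> ('i \<Rightarrow> 'a measure) \<Rightarrow> 'i \<Rightarrow> (('i \<Rightarrow> 'a) \<Rightarrow> 'a measure) \<Rightarrow> ('i \<Rightarrow> 'a) \<Rightarrow> ('i \<Rightarrow> 'a) measure" where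
  "coordinate_kernel I X j q x = distr (q x) (Pi\<^sub>M I X) (\<lambda>y. x(j := y))"

lemma omit_fun_upd [simp]: "omit I j (x(j := y)) = omit I j x"
  by (auto simp: omit_def restrict_def)

lemma measurable_omit [measurable]: "omit I j \<in> Pi\<^sub>M I X \<rightarrow>\<^sub>M Pi\<^sub>M (I - {j}) X"
  using measurable_restrict_subset[of "I - {j}" I X] by (simp add: omit_def[abs_def])

lemma measurable_coordinate_update:
  assumes "j \<in> I"
  shows "(\<lambda>(x, y). x(j := y)) \<in> Pi\<^sub>M I X \<Otimes>\<^sub>M X j \<rightarrow>\<^sub>M Pi\<^sub>M I X"
  using measurable_add_dim[of j I X] assms by (simp add: insert_absorb)

lemma measurable_coordinate_section:
  assumes "j \<in> I" "x \<in> space (Pi\<^sub>M I X)"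
  shows "(\<lambda>y. x(j := y)) \<in> X j \<rightarrow>\<^sub>M Pi\<^sub>M I X"
  using measurable_compose[OF measurable_Pair1'[OF assms(2)] measurable_coordinate_update[OF assms(1)]]
  by simp

lemma coordinate_kernel_measurable:
  assumes j: "j \<in> I" and q: "q \<in> Pi\<^sub>M I X \<rightarrow>\<^sub>M prob_algebra (X j)"
  shows "coordinate_kernel I X j q \<in> Pi\<^sub>M I X \<rightarrow>\<^sub>M prob_algebra (Pi\<^sub>M I X)"
proof (rule measurable_prob_algebraI)
  fix x assume x: "x \<in> space (Pi\<^sub>M I X)"
  then have q_x: "sets (q x) = sets (X j)" "prob_space (q x)"
    using measurable_space[OF q x] by (auto simp: space_prob_algebra)
  have "(\<lambda>y. x(j := y)) \<in> q x \<rightarrow>\<^sub>M Pi\<^sub>M I X"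
    using measurable_coordinate_section[OF j x] by (simp add: measurable_cong_sets[OF q_x(1) refl])
  then show "prob_space (coordinate_kernel I X j q x)"
    unfolding coordinate_kernel_def by (rule prob_space.prob_space_distr[OF q_x(2)])
next
  show "coordinate_kernel I X j q \<in> Pi\<^sub>M I X \<rightarrow>\<^sub>M subprob_algebra (Pi\<^sub>M I X)"
    unfolding coordinate_kernel_def[abs_def]
    using measurable_coordinate_update[OF j] measurable_prob_algebraD[OF q]
    by (rule measurable_distr2)
qed

locale coordinate_resampling = prob_space Q
  for I :: "'i set" and X :: "'i \<Rightarrow> 'a measure" and Q :: "('i \<Rightarrow> 'a) measure" and j :: 'i
    and p :: "('i \<Rightarrow> 'a) \<Rightarrow> 'a measure" and k :: "('i \<Rightarrow> 'a) \<Rightarrow> 'a \<Rightarrow> 'a measure" +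
  assumes coordinate: "j \<in> I"
    and sets_Q: "sets Q = sets (Pi\<^sub>M I X)"
    and conditional: "regular_conditional_distribution I X Q j p"
    and componentwise: "componentwise_kernel I X j p k"
begin

definition gibbs_kernel :: "('i \<Rightarrow> 'a) \<Rightarrow> ('i \<Rightarrow> 'a) measure" where
  "gibbs_kernel = coordinate_kernel I X j (\<lambda>x. p (omit I j x))"

definition update_kernel :: "('i \<Rightarrow> 'a) \<Rightarrow> ('i \<Rightarrow> 'a) measure" where
  "update_kernel = coordinate_kernel I X j (\<lambda>x. k (omit I j x) (x j))"

lemma space_Q: "space Q = space (Pi\<^sub>M I X)"
  by (rule sets_eq_imp_space_eq[OF sets_Q])

lemma measurable_Q: "measurable Q N = measurable (Pi\<^sub>M I X) N"
  by (rule measurable_cong_sets[OF sets_Q refl])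

lemma borel_measurable_Q: "f \<in> borel_measurable Q \<longleftrightarrow> f \<in> borel_measurable (Pi\<^sub>M I X)"
  by (simp add: measurable_Q)

lemma omit_space: "x \<in> space Q \<Longrightarrow> omit I j x \<in> space (Pi\<^sub>M (I - {j}) X)"
  using measurable_space[OF measurable_omit] by (simp add: space_Q)

lemma coordinate_space: "x \<in> space Q \<Longrightarrow> x j \<in> space (X j)"
  using coordinate by (auto simp: space_Q space_PiM)

lemma upd_space: "x \<in> space Q \<Longrightarrow> y \<in> space (X j) \<Longrightarrow> x(j := y) \<in> space Q"
  unfolding space_Q by (rule measurable_space[OF measurable_coordinate_section[OF coordinate]])

lemma p_measurable [measurable]: "p \<in> Pi\<^sub>M (I - {j}) X \<rightarrow>\<^sub>M prob_algebra (X j)"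
  using conditional by (simp add: regular_conditional_distribution_def)

lemma sets_p: "z \<in> space (Pi\<^sub>M (I - {j}) X) \<Longrightarrow> sets (p z) = sets (X j)"
  using measurable_space[OF p_measurable] by (auto simp: space_prob_algebra)

lemma k_measurable: "z \<in> space (Pi\<^sub>M (I - {j}) X) \<Longrightarrow> k z \<in> X j \<rightarrow>\<^sub>M prob_algebra (X j)"
  using componentwise by (simp add: componentwise_kernel_def markov_kernel_def)

lemma sets_k: "z \<in> space (Pi\<^sub>M (I - {j}) X) \<Longrightarrow> y \<in> space (X j) \<Longrightarrow> sets (k z y) = sets (X j)"
  and prob_space_k: "z \<in> space (Pi\<^sub>M (I - {j}) X) \<Longrightarrow> y \<in> space (X j) \<Longrightarrow> prob_space (k z y)"
  using measurable_space[OF k_measurable] by (auto simp: space_prob_algebra)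

lemma gibbs_conditional_measurable:
  "(\<lambda>x. p (omit I j x)) \<in> Pi\<^sub>M I X \<rightarrow>\<^sub>M prob_algebra (X j)"
  by measurable

lemma update_conditional_measurable:
  "(\<lambda>x. k (omit I j x) (x j)) \<in> Pi\<^sub>M I X \<rightarrow>\<^sub>M prob_algebra (X j)"
proof (intro measurable_prob_algebraI measurable_subprob_algebra)
  fix x assume "x \<in> space (Pi\<^sub>M I X)"
  then have x: "x \<in> space Q" by (simp add: space_Q)
  show "prob_space (k (omit I j x) (x j))" "sets (k (omit I j x) (x j)) = sets (X j)"
    using prob_space_k sets_k omit_space[OF x] coordinate_space[OF x] by auto
  then show "subprob_space (k (omit I j x) (x j))"
    by (simp add: prob_space_imp_subprob_space)
next
  show "(\<lambda>x. emeasure (k (omit I j x) (x j)) A) \<in> borel_measurable (Pi\<^sub>M I X)"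
    if "A \<in> sets (X j)" for A
    using componentwise that by (simp add: componentwise_kernel_def)
qed

lemma markov_gibbs_kernel: "markov_kernel Q gibbs_kernel"
  and markov_update_kernel: "markov_kernel Q update_kernel"
  using coordinate_kernel_measurable[OF coordinate gibbs_conditional_measurable]
    coordinate_kernel_measurable[OF coordinate update_conditional_measurable]
  by (simp_all add: markov_kernel_def gibbs_kernel_def update_kernel_def measurable_Q
      prob_algebra_def subprob_algebra_cong[OF sets_Q])

lemma section_measurable:
  assumes "x \<in> space Q" "sets m = sets (X j)"
  shows "(\<lambda>y. x(j := y)) \<in> m \<rightarrow>\<^sub>M Pi\<^sub>M I X"
  using measurable_coordinate_section[OF coordinate, of x X] assms
  by (simp add: space_Q measurable_cong_sets[OF assms(2) refl])

lemma gibbs_update_eq: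
  assumes "f \<in> borel_measurable Q" "x \<in> space Q"
  shows "gibbs_update I j p f x = (\<integral>y. f y \<partial>gibbs_kernel x)"
  unfolding gibbs_update_def gibbs_kernel_def coordinate_kernel_def
  using assms by (intro integral_distr[symmetric] section_measurable)
    (auto simp: borel_measurable_Q sets_p omit_space)

lemma componentwise_update_eq:
  assumes "f \<in> borel_measurable Q" "x \<in> space Q"
  shows "componentwise_update I j k f x = (\<integral>y. f y \<partial>update_kernel x)"
  unfolding componentwise_update_def update_kernel_def coordinate_kernel_def
  using assms by (intro integral_distr[symmetric] section_measurable)
    (auto simp: borel_measurable_Q sets_k omit_space coordinate_space)

lemma emeasure_gibbs_kernel:
  assumes "x \<in> space Q" "E \<in> sets Q"
  shows "emeasure (gibbs_kernel x) E = emeasure (p (omit I j x)) {y \<in> space (X j). x(j := y) \<in> E}"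
proof -
  have s: "sets (p (omit I j x)) = sets (X j)" by (simp add: sets_p omit_space assms)
  show ?thesis
    using assms sets_eq_imp_space_eq[OF s]
    by (simp add: gibbs_kernel_def coordinate_kernel_def emeasure_distr section_measurable s
        sets_Q vimage_def Int_def conj_commute)
qed

lemma emeasure_update_kernel:
  assumes "x \<in> space Q" "E \<in> sets Q"
  shows "emeasure (update_kernel x) E = emeasure (k (omit I j x) (x j)) {y \<in> space (X j). x(j := y) \<in> E}"
proof -
  have s: "sets (k (omit I j x) (x j)) = sets (X j)"
    by (simp add: sets_k omit_space coordinate_space assms)
  show ?thesis
    using assms sets_eq_imp_space_eq[OF s]
    by (simp add: update_kernel_def coordinate_kernel_def emeasure_distr section_measurable s
        sets_Q vimage_def Int_def conj_commute)
qed

lemma measurable_gibbs_kernel: "gibbs_kernel \<in> Q \<rightarrow>\<^sub>M subprob_algebra Q"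
  and measurable_update_kernel: "update_kernel \<in> Q \<rightarrow>\<^sub>M subprob_algebra Q"
  using markov_gibbs_kernel markov_update_kernel
  by (auto simp: markov_kernel_def intro: measurable_prob_algebraD)

text \<open>
  Splitting off coordinate \<open>j\<close> identifies the product with a binary one, whose sigma-algebra is
  generated by rectangles. The conditional distribution is specified on exactly these sets.
\<close>

lemma measure_eqI_split_coordinate:
  assumes M: "sets M = sets (Pi\<^sub>M I X)" and N: "sets N = sets (Pi\<^sub>M I X)" and fin: "finite_measure M"
    and eq: "\<And>A B. A \<in> sets (X j) \<Longrightarrow> B \<in> sets (Pi\<^sub>M (I - {j}) X) \<Longrightarrow>
      emeasure M {x \<in> space (Pi\<^sub>M I X). x j \<in> A \<and> omit I j x \<in> B}
      = emeasure N {x \<in> space (Pi\<^sub>M I X). x j \<in> A \<and> omit I j x \<in> B}"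
  shows "M = N"
proof -
  let ?Z = "Pi\<^sub>M (I - {j}) X"
  let ?split = "\<lambda>x. (omit I j x, x j)" and ?join = "\<lambda>(z, y). z(j := y)"
  have [measurable]: "(\<lambda>x. x j) \<in> Pi\<^sub>M I X \<rightarrow>\<^sub>M X j"
    using coordinate by (rule measurable_component_singleton)
  have split: "?split \<in> Pi\<^sub>M I X \<rightarrow>\<^sub>M ?Z \<Otimes>\<^sub>M X j"
    by measurable
  have join: "?join \<in> ?Z \<Otimes>\<^sub>M X j \<rightarrow>\<^sub>M Pi\<^sub>M I X"
    using measurable_add_dim[of j "I - {j}" X] coordinate by (simp add: insert_absorb)
  have spaces: "space M = space (Pi\<^sub>M I X)" "space N = space (Pi\<^sub>M I X)"
    using M N by (auto dest: sets_eq_imp_space_eq)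
  have split': "?split \<in> M \<rightarrow>\<^sub>M ?Z \<Otimes>\<^sub>M X j" "?split \<in> N \<rightarrow>\<^sub>M ?Z \<Otimes>\<^sub>M X j"
    using split by (simp_all add: measurable_cong_sets[OF M refl] measurable_cong_sets[OF N refl])
  interpret D: finite_measure "distr M (?Z \<Otimes>\<^sub>M X j) ?split"
    using split' fin by (intro finite_measure.finite_measure_distr)
  have "distr M (?Z \<Otimes>\<^sub>M X j) ?split = distr N (?Z \<Otimes>\<^sub>M X j) ?split"
  proof (rule measure_eqI_generator_eq[OF Int_stable_pair_measure_generator[of ?Z "X j"]])
    show "{a \<times> b |a b. a \<in> sets ?Z \<and> b \<in> sets (X j)} \<subseteq> Pow (space ?Z \<times> space (X j))"
      by (rule pair_measure_closed)
    show "range (\<lambda>i::nat. space ?Z \<times> space (X j)) \<subseteq> {a \<times> b |a b. a \<in> sets ?Z \<and> b \<in> sets (X j)}"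
      by auto
    show "emeasure (distr M (?Z \<Otimes>\<^sub>M X j) ?split) R = emeasure (distr N (?Z \<Otimes>\<^sub>M X j) ?split) R"
      if R: "R \<in> {a \<times> b |a b. a \<in> sets ?Z \<and> b \<in> sets (X j)}" for R
    proof -
      from R obtain B A where BA: "R = B \<times> A" "B \<in> sets ?Z" "A \<in> sets (X j)" by auto
      then have R_sets: "R \<in> sets (?Z \<Otimes>\<^sub>M X j)" by simp
      have pre: "?split -` R \<inter> space (Pi\<^sub>M I X) = {x \<in> space (Pi\<^sub>M I X). x j \<in> A \<and> omit I j x \<in> B}"
        using BA by auto
      show ?thesis
        using eq[OF BA(3,2)] by (simp add: emeasure_distr[OF split'(1) R_sets]
            emeasure_distr[OF split'(2) R_sets] spaces pre)
    qed
  qed (auto simp: sets_pair_measure)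
  then have "distr (distr M (?Z \<Otimes>\<^sub>M X j) ?split) (Pi\<^sub>M I X) ?join
      = distr (distr N (?Z \<Otimes>\<^sub>M X j) ?split) (Pi\<^sub>M I X) ?join" by simp
  moreover have "distr (distr L (?Z \<Otimes>\<^sub>M X j) ?split) (Pi\<^sub>M I X) ?join = L"
    if L: "sets L = sets (Pi\<^sub>M I X)" for L
  proof -
    have s: "?split \<in> L \<rightarrow>\<^sub>M ?Z \<Otimes>\<^sub>M X j"
      using split by (simp add: measurable_cong_sets[OF L refl])
    have "distr (distr L (?Z \<Otimes>\<^sub>M X j) ?split) (Pi\<^sub>M I X) ?join = distr L L (\<lambda>x. x)"
      unfolding distr_distr[OF join s]
    proof (rule distr_cong)
      fix x assume "x \<in> space L"
      then have "x \<in> space (Pi\<^sub>M I X)" using sets_eq_imp_space_eq[OF L] by simp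
      then show "(?join \<circ> ?split) x = x"
        using coordinate
        by (auto simp: omit_def fun_eq_iff space_PiM PiE_def extensional_def)
    qed (simp_all add: L)
    then show ?thesis by (simp add: distr_id)
  qed
  ultimately show ?thesis using M N by simp
qed

lemma gibbs_stationary: "Q \<bind> gibbs_kernel = Q"
proof (rule measure_eqI_split_coordinate)
  have ne: "space Q \<noteq> {}" by (rule not_empty)
  show s: "sets (Q \<bind> gibbs_kernel) = sets (Pi\<^sub>M I X)"
    using sets_bind[OF sets_kernel[OF measurable_gibbs_kernel] ne] by (simp add: sets_Q)
  show "sets Q = sets (Pi\<^sub>M I X)" by (rule sets_Q)
  show "finite_measure (Q \<bind> gibbs_kernel)"
    using prob_space_bind'[of Q Q gibbs_kernel] markov_gibbs_kernel prob_space_axioms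
    by (intro prob_space.finite_measure) (auto simp: markov_kernel_def space_prob_algebra)
  fix A B assume A: "A \<in> sets (X j)" and B: "B \<in> sets (Pi\<^sub>M (I - {j}) X)"
  let ?E = "{x \<in> space (Pi\<^sub>M I X). x j \<in> A \<and> omit I j x \<in> B}"
  have [measurable]: "(\<lambda>x. x j) \<in> Pi\<^sub>M I X \<rightarrow>\<^sub>M X j"
    using coordinate by (rule measurable_component_singleton)
  note [measurable] = A B
  have E: "?E \<in> sets Q"
    unfolding sets_Q by measurable
  have m: "(\<lambda>z. emeasure (p z) A) \<in> borel_measurable (Pi\<^sub>M (I - {j}) X)"
    by (rule measurable_compose[OF measurable_prob_algebraD[OF p_measurable]
          measurable_emeasure_subprob_algebra[OF A]])
  have omit_Q: "omit I j \<in> Q \<rightarrow>\<^sub>M Pi\<^sub>M (I - {j}) X"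
    by (simp add: measurable_Q)
  have "emeasure (Q \<bind> gibbs_kernel) ?E = (\<integral>\<^sup>+x. emeasure (gibbs_kernel x) ?E \<partial>Q)"
    using ne measurable_gibbs_kernel E by (rule emeasure_bind)
  also have "\<dots> = (\<integral>\<^sup>+x. emeasure (p (omit I j x)) A * indicator B (omit I j x) \<partial>Q)"
  proof (rule nn_integral_cong)
    fix x assume x: "x \<in> space Q"
    have "{y \<in> space (X j). x(j := y) \<in> ?E} = (if omit I j x \<in> B then A else {})"
      using upd_space[OF x] sets.sets_into_space[OF A] by (auto simp: space_Q)
    then show "emeasure (gibbs_kernel x) ?E = emeasure (p (omit I j x)) A * indicator B (omit I j x)"
      by (simp only: emeasure_gibbs_kernel[OF x E]) simp
  qed
  also have "\<dots> = (\<integral>\<^sup>+z\<in>B. emeasure (p z) A \<partial>distr Q (Pi\<^sub>M (I - {j}) X) (omit I j))"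
    using m by (intro nn_integral_distr[symmetric] omit_Q borel_measurable_times_ennreal) auto
  also have "\<dots> = emeasure Q {x \<in> space Q. x j \<in> A \<and> omit I j x \<in> B}"
    using conditional A B by (simp add: regular_conditional_distribution_def)
  finally show "emeasure (Q \<bind> gibbs_kernel) ?E = emeasure Q ?E"
    by (simp add: space_Q)
qed

lemma nn_integral_gibbs_kernel:
  assumes "f \<in> borel_measurable Q" "x \<in> space Q"
  shows "(\<integral>\<^sup>+y. f y \<partial>gibbs_kernel x) = (\<integral>\<^sup>+y. f (x(j := y)) \<partial>p (omit I j x))"
  unfolding gibbs_kernel_def coordinate_kernel_def
  using assms by (intro nn_integral_distr section_measurable)
    (auto simp: borel_measurable_Q sets_p omit_space)

text \<open>
  Taking one of the two sets in the reversibility condition to be the whole space gives stationarity.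
\<close>

lemma conditional_stationary:
  assumes z: "z \<in> space (Pi\<^sub>M (I - {j}) X)" and A: "A \<in> sets (X j)"
  shows "(\<integral>\<^sup>+y. emeasure (k z y) A \<partial>p z) = emeasure (p z) A"
proof -
  have rev: "reversible_wrt (p z) (k z)"
    using componentwise z by (simp add: componentwise_kernel_def)
  have sp: "space (p z) = space (X j)" by (rule sets_eq_imp_space_eq[OF sets_p[OF z]])
  have A': "A \<in> sets (p z)" using A by (simp add: sets_p[OF z])
  have "(\<integral>\<^sup>+y. emeasure (k z y) A \<partial>p z) = (\<integral>\<^sup>+y\<in>space (p z). emeasure (k z y) A \<partial>p z)"
    by (intro nn_integral_cong) simp
  also have "\<dots> = (\<integral>\<^sup>+y\<in>A. emeasure (k z y) (space (p z)) \<partial>p z)"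
    using rev A' unfolding reversible_wrt_def by blast
  also have "\<dots> = (\<integral>\<^sup>+y. indicator A y \<partial>p z)"
  proof (rule nn_integral_cong)
    fix y assume "y \<in> space (p z)"
    then have y: "y \<in> space (X j)" by (simp add: sp)
    have "emeasure (k z y) (space (p z)) = 1"
      using prob_space.emeasure_space_1[OF prob_space_k[OF z y]]
        sets_eq_imp_space_eq[OF sets_k[OF z y]] by (simp add: sp)
    then show "emeasure (k z y) (space (p z)) * indicator A y = indicator A y" by simp
  qed
  also have "\<dots> = emeasure (p z) A" using A' by simp
  finally show ?thesis .
qed

text \<open>
  By stationarity of the Gibbs kernel, coordinate \<open>j\<close> may be redrawn from its conditional distribution
  before the update; given \<open>x\<^sub>-\<^sub>j\<close>, the update then preserves that distribution.
\<close>

lemma update_stationary: "Q \<bind> update_kernel = Q"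
proof (rule measure_eqI)
  have ne: "space Q \<noteq> {}" by (rule not_empty)
  show s: "sets (Q \<bind> update_kernel) = sets Q"
    using sets_bind[OF sets_kernel[OF measurable_update_kernel] ne] by simp
  fix E assume "E \<in> sets (Q \<bind> update_kernel)"
  then have E: "E \<in> sets Q" by (simp add: s)
  have m: "(\<lambda>x. emeasure (update_kernel x) E) \<in> borel_measurable Q"
    by (rule measurable_compose[OF measurable_update_kernel measurable_emeasure_subprob_algebra[OF E]])
  have "emeasure (Q \<bind> update_kernel) E = (\<integral>\<^sup>+x. emeasure (update_kernel x) E \<partial>Q)"
    using ne measurable_update_kernel E by (rule emeasure_bind)
  also have "\<dots> = (\<integral>\<^sup>+x. \<integral>\<^sup>+y. emeasure (update_kernel y) E \<partial>gibbs_kernel x \<partial>Q)"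
    using nn_integral_bind[OF m measurable_gibbs_kernel] by (simp add: gibbs_stationary)
  also have "\<dots> = (\<integral>\<^sup>+x. emeasure (gibbs_kernel x) E \<partial>Q)"
  proof (rule nn_integral_cong)
    fix x assume x: "x \<in> space Q"
    let ?A = "{y \<in> space (X j). x(j := y) \<in> E}"
    have A: "?A \<in> sets (X j)"
      using measurable_sets[OF section_measurable[OF x refl], of E] E
      by (simp add: sets_Q vimage_def Int_def conj_commute)
    have sp: "space (p (omit I j x)) = space (X j)"
      by (rule sets_eq_imp_space_eq[OF sets_p[OF omit_space[OF x]]])
    have "(\<integral>\<^sup>+y. emeasure (update_kernel y) E \<partial>gibbs_kernel x)
        = (\<integral>\<^sup>+y. emeasure (update_kernel (x(j := y))) E \<partial>p (omit I j x))"
      by (rule nn_integral_gibbs_kernel[OF m x])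
    also have "\<dots> = (\<integral>\<^sup>+y. emeasure (k (omit I j x) y) ?A \<partial>p (omit I j x))"
      by (intro nn_integral_cong) (simp add: sp emeasure_update_kernel[OF upd_space[OF x] E])
    also have "\<dots> = emeasure (gibbs_kernel x) E"
      by (simp add: conditional_stationary[OF omit_space[OF x] A] emeasure_gibbs_kernel[OF x E])
    finally show "(\<integral>\<^sup>+y. emeasure (update_kernel y) E \<partial>gibbs_kernel x) = emeasure (gibbs_kernel x) E" .
  qed
  also have "\<dots> = emeasure Q E"
    using emeasure_bind[OF ne measurable_gibbs_kernel E] by (simp add: gibbs_stationary)
  finally show "emeasure (Q \<bind> update_kernel) E = emeasure Q E" .
qed

sublocale gibbs: stationary_kernel Q gibbs_kernel
  by unfold_locales (rule markov_gibbs_kernel gibbs_stationary)+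

sublocale update: stationary_kernel Q update_kernel
  by unfold_locales (rule markov_update_kernel update_stationary)+

definition ignores_coordinate :: "(('i \<Rightarrow> 'a) \<Rightarrow> real) \<Rightarrow> bool" where
  "ignores_coordinate h \<longleftrightarrow> (\<forall>x \<in> space Q. \<forall>y \<in> space (X j). h (x(j := y)) = h x)"

lemma ignores_coordinate_gibbs: "ignores_coordinate (gibbs_update I j p f)"
  by (simp add: ignores_coordinate_def gibbs_update_def)

lemma ignores_coordinate_gibbs_diff:
  "ignores_coordinate (\<lambda>x. gibbs_update I j p f x - c)"
  using ignores_coordinate_gibbs by (simp add: ignores_coordinate_def)

lemma AE_coordinate_kernel_eq:
  assumes h: "h \<in> borel_measurable Q" and inv: "ignores_coordinate h" and x: "x \<in> space Q"
    and q: "sets (q x) = sets (X j)"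
  shows "AE y in coordinate_kernel I X j q x. h y = h x"
proof -
  have [measurable]: "h \<in> borel_measurable (Pi\<^sub>M I X)" using h by (simp add: borel_measurable_Q)
  have "{y \<in> space (Pi\<^sub>M I X). h y = h x} \<in> sets (Pi\<^sub>M I X)"
    by measurable
  then show ?thesis
    unfolding coordinate_kernel_def
    using inv x sets_eq_imp_space_eq[OF q]
    by (subst AE_distr_iff) (auto intro!: section_measurable[OF x q] AE_I2 simp: ignores_coordinate_def)
qed

lemma AE_gibbs_kernel_eq:
  assumes "h \<in> borel_measurable Q" "ignores_coordinate h" "x \<in> space Q"
  shows "AE y in gibbs_kernel x. h y = h x"
  unfolding gibbs_kernel_def using assms
  by (intro AE_coordinate_kernel_eq) (auto simp: sets_p omit_space)

lemma AE_update_kernel_eq: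
  assumes "h \<in> borel_measurable Q" "ignores_coordinate h" "x \<in> space Q"
  shows "AE y in update_kernel x. h y = h x"
  unfolding update_kernel_def using assms
  by (intro AE_coordinate_kernel_eq) (auto simp: sets_k omit_space coordinate_space)

lemma gibbs_update_L2: "f \<in> L2 Q \<Longrightarrow> gibbs_update I j p f \<in> L2 Q"
  using gibbs.kernel_L2[of f] L2_cong[of Q "gibbs_update I j p f" "\<lambda>x. \<integral>y. f y \<partial>gibbs_kernel x"]
  by (simp add: gibbs_update_eq L2_measurable)

lemma componentwise_update_L2: "f \<in> L2 Q \<Longrightarrow> componentwise_update I j k f \<in> L2 Q"
  using update.kernel_L2[of f]
    L2_cong[of Q "componentwise_update I j k f" "\<lambda>x. \<integral>y. f y \<partial>update_kernel x"]
  by (simp add: componentwise_update_eq L2_measurable)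

lemma L2_inner_gibbs_update:
  assumes "h \<in> L2 Q" "ignores_coordinate h" "g \<in> L2 Q"
  shows "L2_inner Q h (gibbs_update I j p g) = L2_inner Q h g"
  using L2_inner_cong[of Q "gibbs_update I j p g" "\<lambda>x. \<integral>y. g y \<partial>gibbs_kernel x" h] assms
    gibbs.L2_inner_kernel[OF assms(1,3) AE_gibbs_kernel_eq]
  by (simp add: gibbs_update_eq L2_measurable)

lemma L2_inner_componentwise_update:
  assumes "h \<in> L2 Q" "ignores_coordinate h" "g \<in> L2 Q"
  shows "L2_inner Q h (componentwise_update I j k g) = L2_inner Q h g"
  using L2_inner_cong[of Q "componentwise_update I j k g" "\<lambda>x. \<integral>y. g y \<partial>update_kernel x" h] assms
    update.L2_inner_kernel[OF assms(1,3) AE_update_kernel_eq]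
  by (simp add: componentwise_update_eq L2_measurable)

text \<open>
  The residual of the Gibbs update is orthogonal to the functions that ignore coordinate \<open>j\<close>, which
  makes the update the best approximation by such functions.
\<close>

lemma gibbs_pythagoras:
  assumes f: "f \<in> L2 Q" and h: "h \<in> L2 Q" "ignores_coordinate h"
  shows "(L2_norm Q (\<lambda>x. f x - h x))\<^sup>2
    = (L2_norm Q (\<lambda>x. f x - gibbs_update I j p f x))\<^sup>2 + (L2_norm Q (\<lambda>x. gibbs_update I j p f x - h x))\<^sup>2"
proof -
  let ?P = "gibbs_update I j p f"
  let ?v = "\<lambda>x. ?P x - h x" and ?r = "\<lambda>x. f x - ?P x"
  note P = gibbs_update_L2[OF f]
  have v: "?v \<in> L2 Q" by (rule L2_diff[OF P h(1)])
  have r: "?r \<in> L2 Q" by (rule L2_diff[OF f P])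
  have "ignores_coordinate ?v"
    using h(2) ignores_coordinate_gibbs by (simp add: ignores_coordinate_def)
  then have "L2_inner Q ?v ?r = 0"
    using L2_inner_diff_right[OF v f P] L2_inner_gibbs_update[OF v _ f] by simp
  then show ?thesis
    using L2_norm_add_square[OF v r] by simp
qed

lemma L2_inner_self_gibbs_update:
  assumes f: "f \<in> L2 Q"
  shows "L2_inner Q f (gibbs_update I j p f)
    = (L2_norm Q f)\<^sup>2 - (L2_norm Q (\<lambda>x. f x - gibbs_update I j p f x))\<^sup>2"
proof -
  have "L2_inner Q f (gibbs_update I j p f) = L2_inner Q (gibbs_update I j p f) (gibbs_update I j p f)"
    using L2_inner_gibbs_update[OF gibbs_update_L2[OF f] ignores_coordinate_gibbs f]
    by (simp add: L2_inner_commute)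
  moreover have "ignores_coordinate (\<lambda>_. 0)" by (simp add: ignores_coordinate_def)
  ultimately show ?thesis
    using gibbs_pythagoras[OF f L2_const[OF finite_measure_axioms, of 0]] by (simp add: L2_norm_square)
qed

text \<open>
  How far \<open>f - c\<close> is from its projection is at most its distance to any function that ignores
  coordinate \<open>j\<close>. Testing with \<open>P\<^sub>j u - c\<close> transfers the residual of \<open>u\<close>, a later iterate of the sweep,
  back to the initial function. The shift by \<open>c\<close> is built in because the gap of the random scan applies to
  centred functions.
\<close>

lemma gibbs_residual_le:
  assumes f: "f \<in> L2 Q" and u: "u \<in> L2 Q"
  shows "L2_norm Q (\<lambda>x. (f x - c) - gibbs_update I j p (\<lambda>x. f x - c) x)
    \<le> L2_norm Q (\<lambda>x. f x - u x) + L2_norm Q (\<lambda>x. u x - gibbs_update I j p u x)"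
proof -
  let ?g = "\<lambda>x. f x - c" and ?h = "\<lambda>x. gibbs_update I j p u x - c"
  note P = gibbs_update_L2[OF u]
  have g: "?g \<in> L2 Q" and h: "?h \<in> L2 Q"
    by (auto intro!: L2_diff f P L2_const finite_measure_axioms)
  have "(L2_norm Q (\<lambda>x. ?g x - gibbs_update I j p ?g x))\<^sup>2 \<le> (L2_norm Q (\<lambda>x. ?g x - ?h x))\<^sup>2"
    using gibbs_pythagoras[OF g h ignores_coordinate_gibbs_diff] by simp
  then have "L2_norm Q (\<lambda>x. ?g x - gibbs_update I j p ?g x) \<le> L2_norm Q (\<lambda>x. ?g x - ?h x)"
    by (rule power2_le_imp_le) simp
  then show ?thesis
    using L2_norm_triangle_diff[OF f u P] by simp
qed

end

locale contracting_resampling = coordinate_resampling +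
  fixes lam :: real
  assumes contraction:
    "L2_opnorm Q (componentwise_update I j k - gibbs_update I j p) \<le> ereal lam"
begin

abbreviation residual :: "(('a \<Rightarrow> 'b) \<Rightarrow> real) \<Rightarrow> real" where
  "residual u \<equiv> L2_norm Q (\<lambda>x. u x - gibbs_update I j p u x)"

text \<open>
  \<open>D\<close> is \<open>(K\<^sub>j - P\<^sub>j) (u - P\<^sub>j u)\<close>. The update \<open>K\<^sub>j\<close> fixes \<open>P\<^sub>j u\<close>, which does not see coordinate \<open>j\<close>, and
  \<open>P\<^sub>j\<close> annihilates \<open>u - P\<^sub>j u\<close>; so \<open>D\<close> is the difference \<open>K\<^sub>j u - P\<^sub>j u\<close>, while the contraction hypothesis
  bounds it by the residual of \<open>u\<close> instead of its norm.
\<close>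

lemma componentwise_update_decomposition:
  assumes u: "u \<in> L2 Q"
  obtains D where "D \<in> L2 Q" "L2_norm Q D \<le> lam * residual u"
    and "AE x in Q. componentwise_update I j k u x = gibbs_update I j p u x + D x"
    and "\<And>h. h \<in> L2 Q \<Longrightarrow> ignores_coordinate h \<Longrightarrow> L2_inner Q h D = 0"
proof -
  let ?P = "gibbs_update I j p" and ?K = "componentwise_update I j k"
  let ?w = "\<lambda>x. u x - ?P u x"
  let ?D = "(?K - ?P) ?w"
  note Pu = gibbs_update_L2[OF u]
  have w: "?w \<in> L2 Q" by (rule L2_diff[OF u Pu])
  have D_eq: "?D = (\<lambda>x. ?K ?w x - ?P ?w x)" by (simp add: fun_diff_def)
  show thesis
  proof
    show "?D \<in> L2 Q" "L2_norm Q ?D \<le> lam * residual u"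
      using L2_opnorm_leD[OF contraction w] by auto
    show "L2_inner Q h ?D = 0" if h: "h \<in> L2 Q" "ignores_coordinate h" for h
      unfolding D_eq
      using L2_inner_diff_right[OF h(1) componentwise_update_L2[OF w] gibbs_update_L2[OF w]]
        L2_inner_gibbs_update[OF h w] L2_inner_componentwise_update[OF h w] by simp
    have int: "integrable Q u" by (rule L2_integrable[OF finite_measure_axioms u])
    show "AE x in Q. ?K u x = ?P u x + ?D x"
      using gibbs.AE_integrable_kernel[OF int] update.AE_integrable_kernel[OF int] AE_space
    proof eventually_elim
      case (elim x)
      note m = L2_measurable[OF Pu]
      note eqs = gibbs_update_eq[OF L2_measurable elim(3)] componentwise_update_eq[OF L2_measurable elim(3)]
      have "?K ?w x = ?K u x - ?P u x"
        using update.kernel_integral_diff_invariant[OF elim(3,2) m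
            AE_update_kernel_eq[OF m ignores_coordinate_gibbs elim(3)]]
        by (simp only: eqs(2)[OF w] eqs(2)[OF u])
      moreover have "?P ?w x = ?P u x - ?P u x"
        using gibbs.kernel_integral_diff_invariant[OF elim(3,1) m
            AE_gibbs_kernel_eq[OF m ignores_coordinate_gibbs elim(3)]]
        by (simp only: eqs(1)[OF w] eqs(1)[OF u])
      ultimately show ?case by (simp add: D_eq)
    qed
  qed
qed

lemma componentwise_update_energy:
  assumes u: "u \<in> L2 Q"
  shows "(L2_norm Q (\<lambda>x. componentwise_update I j k u x - c))\<^sup>2
    \<le> (L2_norm Q (\<lambda>x. u x - c))\<^sup>2 - (1 - lam\<^sup>2) * (residual u)\<^sup>2"
proof -
  obtain D where D: "D \<in> L2 Q" "L2_norm Q D \<le> lam * residual u"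
    and AE: "AE x in Q. componentwise_update I j k u x = gibbs_update I j p u x + D x"
    and orth: "\<And>h. h \<in> L2 Q \<Longrightarrow> ignores_coordinate h \<Longrightarrow> L2_inner Q h D = 0"
    using componentwise_update_decomposition[OF u] by blast
  let ?h = "\<lambda>x. gibbs_update I j p u x - c"
  note const = L2_const[OF finite_measure_axioms, of c]
  have h: "?h \<in> L2 Q" by (rule L2_diff[OF gibbs_update_L2[OF u] const])
  have "L2_norm Q (\<lambda>x. componentwise_update I j k u x - c) = L2_norm Q (\<lambda>x. ?h x + D x)"
    using AE by (intro L2_norm_cong_AE L2_diff L2_add h D(1) componentwise_update_L2 u const) auto
  then have "(L2_norm Q (\<lambda>x. componentwise_update I j k u x - c))\<^sup>2 = (L2_norm Q ?h)\<^sup>2 + (L2_norm Q D)\<^sup>2"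
    using L2_norm_add_square[OF h D(1)] orth[OF h ignores_coordinate_gibbs_diff] by simp
  moreover have "(L2_norm Q D)\<^sup>2 \<le> lam\<^sup>2 * (residual u)\<^sup>2"
    using power_mono[OF D(2), of 2] by (simp add: power_mult_distrib)
  moreover have "(L2_norm Q (\<lambda>x. u x - c))\<^sup>2 = (residual u)\<^sup>2 + (L2_norm Q ?h)\<^sup>2"
    by (rule gibbs_pythagoras[OF u const]) (simp add: ignores_coordinate_def)
  ultimately show ?thesis by (simp add: algebra_simps)
qed

lemma componentwise_update_displacement:
  assumes u: "u \<in> L2 Q"
  shows "L2_norm Q (\<lambda>x. u x - componentwise_update I j k u x) \<le> (1 + lam) * residual u"
proof -
  obtain D where D: "D \<in> L2 Q" "L2_norm Q D \<le> lam * residual u"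
    and AE: "AE x in Q. componentwise_update I j k u x = gibbs_update I j p u x + D x"
    using componentwise_update_decomposition[OF u] by blast
  note P = gibbs_update_L2[OF u]
  have w: "(\<lambda>x. u x - gibbs_update I j p u x) \<in> L2 Q" by (rule L2_diff[OF u P])
  have "L2_norm Q (\<lambda>x. u x - componentwise_update I j k u x)
      = L2_norm Q (\<lambda>x. (u x - gibbs_update I j p u x) - D x)"
    using AE by (intro L2_norm_cong_AE L2_diff w D(1) componentwise_update_L2 u P) auto
  also have "\<dots> \<le> residual u + L2_norm Q D"
    using L2_norm_triangle[OF w L2_cmult[OF D(1), of "-1"]]
    by (simp add: L2_norm_def)
  finally show ?thesis using D(2) by (simp add: algebra_simps)
qed

end

section \<open>One sweep over the coordinates\<close>

text \<open>
  The arithmetic of a sweep: \<open>b j\<close> is the distance to the mean after \<open>j\<close> updates, \<open>a j\<close> the residual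
  met by the \<open>j\<close>-th update and \<open>e j\<close> the residual of the centred initial function. The Cauchy--Schwarz
  inequality gives \<open>(e j)\<^sup>2 \<le> (1 + lam)\<^sup>2 S j\<close> with \<open>S\<close> the sum of all \<open>(a i)\<^sup>2\<close>, hence by the gap a lower
  bound for \<open>S\<close>.
\<close>

lemma sweep_contraction:
  fixes a b e :: "nat \<Rightarrow> real"
  assumes d: "1 \<le> d" and lam: "0 < lam" "lam < 1" and \<eta>: "0 < \<eta>" "\<eta> \<le> 1"
    and a: "\<And>j. 0 \<le> a j" and b: "0 \<le> b 0"
    and energy: "\<And>j. j < d \<Longrightarrow> (b (Suc j))\<^sup>2 \<le> (b j)\<^sup>2 - (1 - lam\<^sup>2) * (a (Suc j))\<^sup>2"
    and e: "\<And>j. j \<in> {1..d} \<Longrightarrow> 0 \<le> e j"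
    and e_le: "\<And>j. j \<in> {1..d} \<Longrightarrow> e j \<le> (1 + lam) * (\<Sum>i = 1..j. a i)"
    and gap: "real d * \<eta> * (b 0)\<^sup>2 \<le> (\<Sum>j = 1..d. (e j)\<^sup>2)"
  shows "b d \<le> (1 - (1 - lam) ^ 3 / (8 * (real d + 1) * (1 + lam)) * \<eta>) * b 0"
proof -
  define S where "S = (\<Sum>i = 1..d. (a i)\<^sup>2)"
  \<comment> \<open>\<open>2 * t\<close> is the guaranteed relative loss of squared distance, so \<open>1 - t\<close> is a contraction
    rate because \<open>1 - 2 * t \<le> (1 - t)\<^sup>2\<close>; the claimed rate is \<open>1 - t * (1 - lam)\<^sup>2 / 8\<close>.\<close>
  define t where "t = (1 - lam) * \<eta> / ((1 + lam) * (real d + 1))"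
  have "(b n)\<^sup>2 \<le> (b 0)\<^sup>2 - (1 - lam\<^sup>2) * (\<Sum>i = 1..n. (a i)\<^sup>2)" if "n \<le> d" for n
    using that
  proof (induction n)
    case (Suc n)
    then show ?case using energy[of n] by (simp add: algebra_simps)
  qed simp
  then have loss: "(b d)\<^sup>2 \<le> (b 0)\<^sup>2 - (1 - lam\<^sup>2) * S" by (simp add: S_def)
  have e_sq: "(e j)\<^sup>2 \<le> (1 + lam)\<^sup>2 * S * real j" if j: "j \<in> {1..d}" for j
  proof -
    have "(e j)\<^sup>2 \<le> ((1 + lam) * (\<Sum>i = 1..j. a i))\<^sup>2"
      by (rule power_mono[OF e_le[OF j] e[OF j]])
    also have "\<dots> \<le> (1 + lam)\<^sup>2 * ((\<Sum>i = 1..j. (a i)\<^sup>2) * real j)"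
      unfolding power_mult_distrib
      using Cauchy_Schwarz_ineq_sum[of a "\<lambda>_. 1" "{1..j}"] by (intro mult_left_mono) auto
    also have "\<dots> \<le> (1 + lam)\<^sup>2 * (S * real j)"
      unfolding S_def using j by (intro mult_left_mono mult_right_mono sum_mono2) auto
    finally show ?thesis by (simp add: mult.assoc)
  qed
  have "real d * (\<eta> * (b 0)\<^sup>2) \<le> (\<Sum>j = 1..d. (1 + lam)\<^sup>2 * S * real j)"
    using gap sum_mono[OF e_sq, of "{1..d}" "\<lambda>j. j"] by simp
  also have "\<dots> = (1 + lam)\<^sup>2 * S * (\<Sum>j = 1..d. real j)"
    by (simp add: sum_distrib_left)
  also have "(\<Sum>j = 1..d. real j) = real d * (real d + 1) / 2"
    by (induction d) (auto simp: field_simps)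
  finally have "real d * (\<eta> * (b 0)\<^sup>2) \<le> real d * ((1 + lam)\<^sup>2 * S * (real d + 1) / 2)"
    by (simp add: algebra_simps)
  then have S_ge: "\<eta> * (b 0)\<^sup>2 \<le> (1 + lam)\<^sup>2 * S * (real d + 1) / 2"
    using d by simp
  have t: "0 \<le> t" "t \<le> 1"
  proof -
    show "0 \<le> t" using lam \<eta> by (simp add: t_def)
    have "(1 - lam) * \<eta> \<le> 1 * 1" using lam \<eta> by (intro mult_mono) auto
    also have "1 * 1 \<le> (1 + lam) * (real d + 1)" using lam by (intro mult_mono) auto
    finally show "t \<le> 1" using lam by (simp add: t_def divide_le_eq_1)
  qed
  have "2 * t * (b 0)\<^sup>2 = 2 * (1 - lam) / ((1 + lam) * (real d + 1)) * (\<eta> * (b 0)\<^sup>2)"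
    by (simp add: t_def)
  also have "\<dots> \<le> 2 * (1 - lam) / ((1 + lam) * (real d + 1)) * ((1 + lam)\<^sup>2 * S * (real d + 1) / 2)"
    using lam by (intro mult_left_mono S_ge) auto
  also have "\<dots> = (1 - lam) * (1 + lam) * S"
  proof -
    have "2 * (1 - lam) / (A * B) * (A\<^sup>2 * S * B / 2) = (1 - lam) * A * S"
      if "A \<noteq> 0" "B \<noteq> 0" for A B :: real
      using that by (simp add: power2_eq_square)
    from this[of "1 + lam" "real d + 1"] show ?thesis using lam by simp
  qed
  also have "\<dots> = (1 - lam\<^sup>2) * S"
    by (simp add: power2_eq_square algebra_simps)
  finally have "(b d)\<^sup>2 \<le> (1 - 2 * t) * (b 0)\<^sup>2"
    using loss by (simp add: algebra_simps)
  also have "\<dots> \<le> (1 - t)\<^sup>2 * (b 0)\<^sup>2"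
    by (intro mult_right_mono) (simp_all add: power2_eq_square algebra_simps)
  finally have "(b d)\<^sup>2 \<le> ((1 - t) * b 0)\<^sup>2" by (simp add: power_mult_distrib)
  then have "b d \<le> (1 - t) * b 0"
    by (rule power2_le_imp_le) (use t b in simp)
  also have "\<dots> \<le> (1 - (1 - lam) ^ 3 / (8 * (real d + 1) * (1 + lam)) * \<eta>) * b 0"
  proof (intro mult_right_mono b diff_left_mono)
    have "(1 - lam)\<^sup>2 / 8 \<le> 1"
      using power_le_one[of "1 - lam" 2] lam by simp
    then have "t * ((1 - lam)\<^sup>2 / 8) \<le> t" using t(1) by (rule mult_left_le)
    then show "(1 - lam) ^ 3 / (8 * (real d + 1) * (1 + lam)) * \<eta> \<le> t"
      by (simp add: t_def power2_eq_square power3_eq_cube mult_ac)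
  qed
  finally show ?thesis .
qed

text \<open>
  On centred functions the random scan has norm at most \<open>1 - \<eta>\<close>, hence so does its quadratic form,
  which is the average of the quadratic forms \<open>\<parallel>g\<parallel>\<^sup>2 - \<parallel>g - P\<^sub>j g\<parallel>\<^sup>2\<close> of the projections.
\<close>

lemma random_scan_gap:
  assumes d: "1 \<le> d"
    and gap: "L2_opnorm Q (random_scan_gibbs d p - mean_operator Q) \<le> ereal (1 - \<eta>)"
    and P: "\<And>j. j \<in> {1..d} \<Longrightarrow> gibbs_update {1..d} j (p j) g \<in> L2 Q"
    and inner: "\<And>j. j \<in> {1..d} \<Longrightarrow> L2_inner Q g (gibbs_update {1..d} j (p j) g)
      = (L2_norm Q g)\<^sup>2 - (L2_norm Q (\<lambda>x. g x - gibbs_update {1..d} j (p j) g x))\<^sup>2"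
    and g: "g \<in> L2 Q" and centred: "(\<integral>x. g x \<partial>Q) = 0"
  shows "real d * \<eta> * (L2_norm Q g)\<^sup>2
    \<le> (\<Sum>j = 1..d. (L2_norm Q (\<lambda>x. g x - gibbs_update {1..d} j (p j) g x))\<^sup>2)"
proof -
  let ?R = "random_scan_gibbs d p g" and ?P = "\<lambda>j. gibbs_update {1..d} j (p j) g"
  have eq: "(random_scan_gibbs d p - mean_operator Q) g = ?R"
    using centred by (simp add: fun_eq_iff mean_operator_def)
  have R: "?R \<in> L2 Q" and norm: "L2_norm Q ?R \<le> (1 - \<eta>) * L2_norm Q g"
    using L2_opnorm_leD[OF gap g] unfolding eq by auto
  have "(\<integral>x. (\<Sum>j = 1..d. g x * ?P j x) \<partial>Q) = (\<Sum>j = 1..d. L2_inner Q g (?P j))"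
    unfolding L2_inner_def by (intro Bochner_Integration.integral_sum L2_mult_integrable g P)
  then have "real d * L2_inner Q g ?R = (\<Sum>j = 1..d. L2_inner Q g (?P j))"
    using d by (simp add: L2_inner_def random_scan_gibbs_def sum_distrib_left flip: integral_mult_right_zero)
  also have "\<dots> = (\<Sum>j = 1..d. (L2_norm Q g)\<^sup>2 - (L2_norm Q (\<lambda>x. g x - ?P j x))\<^sup>2)"
    by (intro sum.cong inner refl)
  also have "\<dots> = real d * (L2_norm Q g)\<^sup>2 - (\<Sum>j = 1..d. (L2_norm Q (\<lambda>x. g x - ?P j x))\<^sup>2)"
    by (simp add: sum_subtractf)
  finally have sum: "real d * L2_inner Q g ?R
    = real d * (L2_norm Q g)\<^sup>2 - (\<Sum>j = 1..d. (L2_norm Q (\<lambda>x. g x - ?P j x))\<^sup>2)" .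
  have "L2_inner Q g ?R \<le> L2_norm Q g * ((1 - \<eta>) * L2_norm Q g)"
    using L2_Cauchy_Schwarz[OF g R] mult_left_mono[OF norm, of "L2_norm Q g"] by simp
  then have "real d * L2_inner Q g ?R \<le> real d * ((1 - \<eta>) * (L2_norm Q g)\<^sup>2)"
    by (intro mult_left_mono) (simp_all add: power2_eq_square mult_ac)
  then show ?thesis using sum by (simp add: algebra_simps)
qed

lemma L2_norm_centred_le:
  assumes Q: "prob_space Q" and f: "f \<in> L2 Q"
  shows "L2_norm Q (\<lambda>x. f x - (\<integral>y. f y \<partial>Q)) \<le> L2_norm Q f"
proof (rule power2_le_imp_le)
  interpret prob_space Q by (rule Q)
  let ?c = "\<integral>y. f y \<partial>Q"
  have c: "(\<lambda>_. ?c) \<in> L2 Q" by (rule L2_const[OF finite_measure_axioms])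
  have g: "(\<lambda>x. f x - ?c) \<in> L2 Q" by (rule L2_diff[OF f c])
  have "(\<integral>x. f x - ?c \<partial>Q) = 0"
    using L2_integrable[OF finite_measure_axioms f] by (simp add: prob_space)
  then have "L2_inner Q (\<lambda>x. f x - ?c) (\<lambda>_. ?c) = 0"
    by (simp add: L2_inner_def)
  then show "(L2_norm Q (\<lambda>x. f x - ?c))\<^sup>2 \<le> (L2_norm Q f)\<^sup>2"
    using L2_norm_add_square[OF g c] by simp
qed simp

theorem corollary1p2:
  fixes d :: nat
    and X :: "nat \<Rightarrow> 'a measure"
    and Q :: "(nat \<Rightarrow> 'a) measure"
    and p :: "nat \<Rightarrow> (nat \<Rightarrow> 'a) \<Rightarrow> 'a measure"
    and k :: "nat \<Rightarrow> (nat \<Rightarrow> 'a) \<Rightarrow> 'a \<Rightarrow> 'a measure"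
    and lam \<eta> :: real
  assumes "1 \<le> d"
    and "\<And>j. j \<in> {1..d} \<Longrightarrow> polish_measurable_space (X j)"
    and "prob_space Q" and "sets Q = sets (Pi\<^sub>M {1..d} X)"
    and "\<And>j. j \<in> {1..d} \<Longrightarrow> regular_conditional_distribution {1..d} X Q j (p j)"
    and "\<And>j. j \<in> {1..d} \<Longrightarrow> componentwise_kernel {1..d} X j (p j) (k j)"
    and "0 < lam" and "lam < 1"
    and "\<And>j. j \<in> {1..d} \<Longrightarrow>
           L2_opnorm Q (componentwise_update {1..d} j (k j) - gibbs_update {1..d} j (p j)) \<le> ereal lam"
    and "0 < \<eta>" and "\<eta> \<le> 1"
    and "L2_opnorm Q (random_scan_gibbs d p - mean_operator Q) \<le> ereal (1 - \<eta>)"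
  shows "L2_opnorm Q (deterministic_scan_componentwise d k - mean_operator Q)
           \<le> ereal (1 - (1 - lam) ^ 3 / (8 * (real d + 1) * (1 + lam)) * \<eta>)"
proof -
  let ?P = "\<lambda>j. gibbs_update {1..d} j (p j)" and ?K = "\<lambda>j. componentwise_update {1..d} j (k j)"
  let ?rate = "1 - (1 - lam) ^ 3 / (8 * (real d + 1) * (1 + lam)) * \<eta>"
  interpret prob_space Q by fact
  have resampling: "contracting_resampling {1..d} X Q j (p j) (k j) lam" if "j \<in> {1..d}" for j
    using assms that
    by (auto intro!: contracting_resampling.intro coordinate_resampling.intro prob_space_axioms
        simp: coordinate_resampling_axioms_def contracting_resampling_axioms_def)
  note coordinate = contracting_resampling.axioms(1)[OF resampling]
  have rate_nonneg: "0 \<le> ?rate"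
  proof -
    have "(1 - lam) ^ 3 * \<eta> \<le> 1 * 1"
      using assms by (intro mult_mono power_le_one) auto
    also have "1 * 1 \<le> (8 * (real d + 1)) * (1 + lam)"
      using assms by (intro mult_mono) auto
    finally have "(1 - lam) ^ 3 * \<eta> \<le> 8 * (real d + 1) * (1 + lam)" by simp
    moreover have "0 < 8 * (real d + 1) * (1 + lam)"
      using assms(7) by (intro mult_pos_pos) auto
    ultimately have "(1 - lam) ^ 3 * \<eta> / (8 * (real d + 1) * (1 + lam)) \<le> 1"
      by (simp only: divide_le_eq_1_pos)
    then show ?thesis by (simp only: times_divide_eq_left le_diff_eq add_0)
  qed
  have bound: "(\<lambda>x. deterministic_scan_componentwise d k f x - (\<integral>y. f y \<partial>Q)) \<in> L2 Q \<and>
      L2_norm Q (\<lambda>x. deterministic_scan_componentwise d k f x - (\<integral>y. f y \<partial>Q)) \<le> ?rate * L2_norm Q f"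
    if f: "f \<in> L2 Q" for f
  proof -
    define c where "c = (\<integral>y. f y \<partial>Q)"
    define u where "u n = fold ?K [1..<Suc n] f" for n
    define r where "r j = L2_norm Q (\<lambda>x. u (j - 1) x - ?P j (u (j - 1)) x)" for j
    define g where "g = (\<lambda>x. f x - c)"
    have u_0: "u 0 = f" and u_Suc: "u (Suc n) = ?K (Suc n) (u n)" for n
      by (simp_all add: u_def)
    have u: "u n \<in> L2 Q" if "n \<le> d" for n
      using that
    proof (induction n)
      case 0
      then show ?case by (simp add: u_0 f)
    next
      case (Suc n)
      then show ?case
        using coordinate_resampling.componentwise_update_L2[OF coordinate[of "Suc n"]] by (simp add: u_Suc)
    qed
    have const: "(\<lambda>_. c) \<in> L2 Q" by (rule L2_const[OF finite_measure_axioms])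
    have g: "g \<in> L2 Q" unfolding g_def by (rule L2_diff[OF f const])
    have displacement: "L2_norm Q (\<lambda>x. f x - u n x) \<le> (1 + lam) * (\<Sum>i = 1..n. r i)" if "n \<le> d" for n
      using that
    proof (induction n)
      case 0
      then show ?case by (simp add: u_0 L2_norm_def)
    next
      case (Suc n)
      have "L2_norm Q (\<lambda>x. u n x - u (Suc n) x) \<le> (1 + lam) * r (Suc n)"
        using contracting_resampling.componentwise_update_displacement[OF resampling[of "Suc n"] u[of n]] Suc.prems
        by (simp add: u_Suc r_def)
      then show ?case
        using L2_norm_triangle_diff[OF f u[of n] u[of "Suc n"]] Suc by (simp add: algebra_simps)
    qed
    have "L2_norm Q (\<lambda>x. u d x - c) \<le> ?rate * L2_norm Q (\<lambda>x. u 0 x - c)"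
    proof (rule sweep_contraction[where a = r and e = "\<lambda>j. L2_norm Q (\<lambda>x. g x - ?P j g x)"])
      show "(L2_norm Q (\<lambda>x. u (Suc j) x - c))\<^sup>2
          \<le> (L2_norm Q (\<lambda>x. u j x - c))\<^sup>2 - (1 - lam\<^sup>2) * (r (Suc j))\<^sup>2" if "j < d" for j
        using contracting_resampling.componentwise_update_energy[OF resampling[of "Suc j"] u[of j]] that
        by (simp add: u_Suc r_def)
      show "L2_norm Q (\<lambda>x. g x - ?P j g x) \<le> (1 + lam) * (\<Sum>i = 1..j. r i)" if j: "j \<in> {1..d}" for j
      proof -
        obtain n where n: "j = Suc n" "n \<le> d" using j by (cases j) auto
        have "L2_norm Q (\<lambda>x. g x - ?P j g x) \<le> L2_norm Q (\<lambda>x. f x - u n x) + r j"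
          using coordinate_resampling.gibbs_residual_le[OF coordinate[OF j] f u[OF n(2)], of c]
          by (simp add: g_def r_def n(1))
        also have "\<dots> \<le> (1 + lam) * (\<Sum>i = 1..n. r i) + (1 + lam) * r j"
          using displacement[OF n(2)] assms(7) by (intro add_mono) (auto simp: r_def algebra_simps)
        also have "\<dots> = (1 + lam) * (\<Sum>i = 1..j. r i)"
          by (simp add: n(1) algebra_simps)
        finally show ?thesis .
      qed
      have "(\<integral>x. g x \<partial>Q) = 0"
        using L2_integrable[OF finite_measure_axioms f] by (simp add: g_def c_def prob_space)
      then show "real d * \<eta> * (L2_norm Q (\<lambda>x. u 0 x - c))\<^sup>2
          \<le> (\<Sum>j = 1..d. (L2_norm Q (\<lambda>x. g x - ?P j g x))\<^sup>2)"
        using random_scan_gap[OF assms(1,12) coordinate_resampling.gibbs_update_L2[OF coordinate g]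
            coordinate_resampling.L2_inner_self_gibbs_update[OF coordinate g] g]
        by (simp add: u_0 g_def)
    qed (use assms in \<open>auto simp: r_def\<close>)
    also have "\<dots> \<le> ?rate * L2_norm Q f"
      using L2_norm_centred_le[OF assms(3) f] rate_nonneg
      by (intro mult_left_mono) (simp_all add: u_0 c_def)
    moreover have "deterministic_scan_componentwise d k f = u d"
      by (simp add: deterministic_scan_componentwise_def u_def)
    moreover have "(\<lambda>x. u d x - c) \<in> L2 Q"
      by (rule L2_diff[OF u[OF order_refl] const])
    ultimately show ?thesis by (simp add: c_def)
  qed
  show ?thesis
    by (rule L2_opnorm_leI[OF rate_nonneg]) (use bound in \<open>simp_all add: fun_diff_def mean_operator_def\<close>)
qed

end
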